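(* Let $\mathcal{V}$ be a vector space and $T:\mathcal{V}\to\mathcal{V}$ a linear map. Then the linear operator $$U=\begin{pmatrix} T & I\\ I & 0\end{pmatrix}:\mathcal{V}\oplus\mathcal{V}\to\mathcal{V}\oplus\mathcal{V},\qquad U(x,y)=(Tx+y,\,x),$$ is invertible on $\mathcal{V}\oplus\mathcal{V}$, and $T=P_{\mathcal{V}}U_{|\mathcal{V}}$, where $\mathcal{V}$ is identified with $\mathcal{V}\oplus\{0\}$ and $P_{\mathcal{V}}:\mathcal{V}\oplus\mathcal{V}\to\mathcal{V}\oplus\mathcal{V}$, $P_{\mathcal{V}}(x,y)=(x,0)$, is the first coordinate projection; that is, $P_{\mathcal{V}}U(x,0)=(Tx,0)$ for all $x\in\mathcal{V}$.
   Context: Vector spaces are over an arbitrary field. $I$ denotes the identity map of $\mathcal{V}$. *)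

theory Defs
  imports "HOL-Analysis.Product_Vector"
begin

(* A vector space over a field 'k with underlying additive group 'v is given by its scalar
   multiplication s with vector_space s.  The external direct sum V (+) V is the product
   type 'v \<times> 'v with componentwise addition and this scalar multiplication. *)
abbreviation dsum_scale ::
  "('k::field \<Rightarrow> 'v::ab_group_add \<Rightarrow> 'v) \<Rightarrow> 'k \<Rightarrow> 'v \<times> 'v \<Rightarrow> 'v \<times> 'v"
  where "dsum_scale s \<equiv> module_prod.scale s s"

(* Invertibility in the algebra of linear operators: the two-sided inverse is itself linear. *)
definition invertible_operator ::
  "('k::field \<Rightarrow> 'w::ab_group_add \<Rightarrow> 'w) \<Rightarrow> ('w \<Rightarrow> 'w) \<Rightarrow> bool"
  where "invertible_operator s F \<longleftrightarrow>
    Vector_Spaces.linear s s F \<and>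
    (\<exists>G. Vector_Spaces.linear s s G \<and> G \<circ> F = id \<and> F \<circ> G = id)"

(* The 2 x 2 operator matrix with rows (A B) and (C D), acting on column vectors (x, y). *)
definition block_operator ::
  "('v::ab_group_add \<Rightarrow> 'v) \<Rightarrow> ('v \<Rightarrow> 'v) \<Rightarrow> ('v \<Rightarrow> 'v) \<Rightarrow> ('v \<Rightarrow> 'v)
    \<Rightarrow> 'v \<times> 'v \<Rightarrow> 'v \<times> 'v"
  where "block_operator A B C D = (\<lambda>(x, y). (A x + B y, C x + D y))"

definition dilation :: "('v::ab_group_add \<Rightarrow> 'v) \<Rightarrow> 'v \<times> 'v \<Rightarrow> 'v \<times> 'v"
  where "dilation T = block_operator T id id (\<lambda>_. 0)"

(* The identification of V with the subspace V (+) {0}. *)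
definition embed_fst :: "'v::ab_group_add \<Rightarrow> 'v \<times> 'v"
  where "embed_fst x = (x, 0)"

definition proj_fst :: "'v::ab_group_add \<times> 'v \<Rightarrow> 'v \<times> 'v"
  where "proj_fst = (\<lambda>(x, y). (x, 0))"

end

theory Submission
  imports Defs
begin

text \<open>The equation (T x + y, x) = (a, b) can be solved by back substitution: the second
  coordinate forces x = b, and then y = a - T b. Thus U is bijective whatever T is, with the
  explicit inverse (a, b) |-> (b, a - T b). This inverse is again a block matrix with linear
  entries, so \<open>linear_block_operator\<close> gives linearity of both U and its inverse. The
  compression to the first summand is the upper left entry T.\<close>

lemma linear_block_operator:
  fixes s :: "'k::field \<Rightarrow> 'v::ab_group_add \<Rightarrow> 'v"
  assumes "Vector_Spaces.linear s s A" "Vector_Spaces.linear s s B"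
    and "Vector_Spaces.linear s s C" "Vector_Spaces.linear s s D"
  shows "Vector_Spaces.linear (dsum_scale s) (dsum_scale s) (block_operator A B C D)"
proof -
  interpret A: Vector_Spaces.linear s s A by fact
  interpret B: Vector_Spaces.linear s s B by fact
  interpret C: Vector_Spaces.linear s s C by fact
  interpret D: Vector_Spaces.linear s s D by fact
  \<comment> \<open>This supplies the vector space axioms for the direct sum, so that only
    additivity and homogeneity of the block map remain to be checked.\<close>
  interpret P: vector_space_prod s s by unfold_locales
  show ?thesis
    by unfold_locales
      (auto simp: block_operator_def P.scale_def A.add B.add C.add D.add
        A.scale B.scale C.scale D.scale A.vs1.scale_right_distrib split: prod.splits)
qed

theorem theorem2p4:
  fixes s :: "'k::field \<Rightarrow> 'v::ab_group_add \<Rightarrow> 'v"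
    and T :: "'v \<Rightarrow> 'v"
  assumes "vector_space s"
    and "Vector_Spaces.linear s s T"
  shows "(\<forall>x y. dilation T (x, y) = (T x + y, x))
    \<and> invertible_operator (dsum_scale s) (dilation T)
    \<and> (\<forall>x. proj_fst (dilation T (embed_fst x)) = embed_fst (T x))"
proof -
  interpret V: vector_space s by fact
  interpret T: Vector_Spaces.linear s s T by fact
  have zero: "Vector_Spaces.linear s s (\<lambda>_. 0)"
    by unfold_locales auto
  have neg: "Vector_Spaces.linear s s (\<lambda>x. - T x)"
    by unfold_locales (auto simp: T.add T.scale)
  have apply_dilation: "dilation T (x, y) = (T x + y, x)" for x y
    by (simp add: dilation_def block_operator_def)
  \<comment> \<open>The inverse matrix with rows (0 I) and (I -T), read off from x = b, y = a - T
    b.\<close>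
  let ?G = "block_operator (\<lambda>_. 0) id id (\<lambda>x. - T x)"
  have "Vector_Spaces.linear (dsum_scale s) (dsum_scale s) (dilation T)"
    unfolding dilation_def using assms(2) V.linear_id zero by (intro linear_block_operator)
  moreover have "Vector_Spaces.linear (dsum_scale s) (dsum_scale s) ?G"
    using V.linear_id zero neg by (intro linear_block_operator)
  moreover have "?G \<circ> dilation T = id" "dilation T \<circ> ?G = id"
    by (auto simp: fun_eq_iff block_operator_def apply_dilation)
  ultimately have "invertible_operator (dsum_scale s) (dilation T)"
    unfolding invertible_operator_def by blast
  then show ?thesis
    by (simp add: apply_dilation proj_fst_def embed_fst_def)
qed

end
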